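(* Let $\beta \in (1,2)$ and let $\bm u = (u_n)_{n \ge 1} \in [1,(\beta-1)^{-1}]^{\mathbb N}$ be a sequence of thresholds. For all $x \in [0,1]$ and all $m \in \mathbb{N}$ it holds that $$k(m,\bm u,x) \ge \frac{m\log 2}{\log \beta}.$$ Moreover, for each $\varepsilon \in (0,1)$ there exists a constant $C(\varepsilon) > 0$ such that for all $m \in \mathbb{N}$ $$\lambda\Big( \Big\{ x \in [0,1] : k(m,\bm u ,x) - \frac{m \log 2}{\log \beta} > C(\varepsilon) \Big\} \Big) < \varepsilon.$$
   Context: $\lambda$ denotes one-dimensional Lebesgue measure, and $\mathbb N=\{1,2,\dots\}$. Bits of the $\beta$-encoder. Given $\beta\in(1,2)$, a threshold sequence $\bm u=(u_n)_{n\ge1}\in[1,(\beta-1)^{-1}]^{\mathbb N}$ and $x\in[0,1]$, put $x_0=x$ and, for $n\ge 1$, let $b_n=0$ if $\beta x_{n-1}<u_n$ and $b_n=1$ if $\beta x_{n-1}\ge u_n$, and $x_n=\beta x_{n-1}-b_n$. For $k\ge1$ define the closed interval $$\mathcal I_k(\bm u,x)=\Big[\sum_{n=1}^k\frac{b_n}{\beta^n},\ \sum_{n=1}^k\frac{b_n}{\beta^n}+\frac{1}{\beta^k(\beta-1)}\Big],$$ where $b_1,\dots,b_k$ are the first $k$ bits produced from $x$ with thresholds $\bm u$. Dyadic intervals. For $m\ge1$ let $\mathcal D_m$ be the partition of $[0,1]$ into the intervals $\big[\frac{j}{2^m},\frac{j+1}{2^m}\big)$, $0\le j\le 2^m-1$,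 where the point $1$ is added to the last interval ($j=2^m-1$). For $x\in[0,1]$, $\mathcal D_m(x)$ denotes the unique element of $\mathcal D_m$ containing $x$. Finally, $$k(m,\bm u,x)=\inf\{k\ge1:\ \mathcal I_k(\bm u,x)\subseteq\mathcal D_m(x)\},$$ with the convention $\inf\emptyset=+\infty$. *)

theory Defs
  imports "HOL-Analysis.Analysis"
begin

text \<open>
  Sequences of thresholds and of bits are functions on \<^typ>\<open>nat\<close> that are only relevant at
  indices \<open>n \<ge> 1\<close>; the value \<open>u 0\<close> is never used.
\<close>

definition quantize :: "real \<Rightarrow> real \<Rightarrow> real" where
  "quantize v y = (if y < v then 0 else 1)"

primrec enc_state :: "real \<Rightarrow> (nat \<Rightarrow> real) \<Rightarrow> real \<Rightarrow> nat \<Rightarrow> real" where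
  "enc_state \<beta> u x 0 = x"
| "enc_state \<beta> u x (Suc n) =
     \<beta> * enc_state \<beta> u x n - quantize (u (Suc n)) (\<beta> * enc_state \<beta> u x n)"

definition enc_bit :: "real \<Rightarrow> (nat \<Rightarrow> real) \<Rightarrow> real \<Rightarrow> nat \<Rightarrow> real" where
  "enc_bit \<beta> u x n = quantize (u n) (\<beta> * enc_state \<beta> u x (n - 1))"

definition enc_interval :: "real \<Rightarrow> nat \<Rightarrow> (nat \<Rightarrow> real) \<Rightarrow> real \<Rightarrow> real set" where
  "enc_interval \<beta> k u x =
     {(\<Sum>n=1..k. enc_bit \<beta> u x n / \<beta> ^ n) ..
      (\<Sum>n=1..k. enc_bit \<beta> u x n / \<beta> ^ n) + 1 / (\<beta> ^ k * (\<beta> - 1))}"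

definition dyadic_interval :: "nat \<Rightarrow> nat \<Rightarrow> real set" where
  "dyadic_interval m j =
     (if j = 2 ^ m - 1 then {real j / 2 ^ m .. 1}
      else {real j / 2 ^ m ..< (real j + 1) / 2 ^ m})"

definition dyadic_partition :: "nat \<Rightarrow> real set set" where
  "dyadic_partition m = dyadic_interval m ` {0 .. 2 ^ m - 1}"

definition dyadic_cell :: "nat \<Rightarrow> real \<Rightarrow> real set" where
  "dyadic_cell m x = (THE D. D \<in> dyadic_partition m \<and> x \<in> D)"

lemma dyadic_interval_iff:
  assumes "x \<in> {0..1}" "j \<le> 2 ^ m - 1"
  shows "x \<in> dyadic_interval m j \<longleftrightarrow> j = min (nat \<lfloor>x * 2 ^ m\<rfloor>) (2 ^ m - 1)"
proof -
  define N :: nat where "N = 2 ^ m"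
  have N: "N \<ge> 1" "(2::real) ^ m = real N" by (auto simp: N_def)
  have nonneg: "0 \<le> x * real N" and le: "x * real N \<le> real N"
    using assms(1) by (auto simp: mult_left_le_one_le)
  have lower: "real j / real N \<le> x \<longleftrightarrow> j \<le> nat \<lfloor>x * real N\<rfloor>"
    using N(1) nonneg by (simp add: pos_divide_le_eq le_nat_iff le_floor_iff)
  have upper: "x < (real j + 1) / real N \<longleftrightarrow> nat \<lfloor>x * real N\<rfloor> < j + 1"
    using N(1) nonneg by (simp add: pos_less_divide_eq nat_less_iff floor_less_iff add.commute)
  have form: "x \<in> dyadic_interval m j \<longleftrightarrow>
      j \<le> nat \<lfloor>x * real N\<rfloor> \<and> (j = N - 1 \<or> nat \<lfloor>x * real N\<rfloor> < j + 1)"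
    unfolding dyadic_interval_def N(2) N_def[symmetric] lower[symmetric] upper[symmetric]
    using assms(1) by auto
  show ?thesis
    unfolding form using assms(2) unfolding N(2) N_def[symmetric] by linarith
qed

text \<open>The description in \<^const>\<open>dyadic_cell\<close> is proper on the unit interval.\<close>

lemma dyadic_cell_unique:
  assumes "x \<in> {0..1}"
  shows "\<exists>!D. D \<in> dyadic_partition m \<and> x \<in> D"
proof (rule ex1I)
  let ?j = "min (nat \<lfloor>x * 2 ^ m\<rfloor>) (2 ^ m - 1) :: nat"
  show "dyadic_interval m ?j \<in> dyadic_partition m \<and> x \<in> dyadic_interval m ?j"
    using dyadic_interval_iff[OF assms, of ?j m] by (auto simp: dyadic_partition_def)
  show "D = dyadic_interval m ?j" if "D \<in> dyadic_partition m \<and> x \<in> D" for D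
    using that dyadic_interval_iff[OF assms, of _ m] by (auto simp: dyadic_partition_def)
qed

text \<open>In \<^typ>\<open>enat\<close> the infimum of the empty set is \<^term>\<open>\<infinity> :: enat\<close>.\<close>

definition enc_index :: "real \<Rightarrow> nat \<Rightarrow> (nat \<Rightarrow> real) \<Rightarrow> real \<Rightarrow> enat" where
  "enc_index \<beta> m u x =
     Inf {enat k | k. k \<ge> 1 \<and> enc_interval \<beta> k u x \<subseteq> dyadic_cell m x}"

end

theory Submission
  imports Defs
begin

text \<open>
  Since \<open>x\<^sub>k\<close> never leaves \<open>[0, 1/(\<beta> - 1)]\<close>, the \<open>k\<close>-th interval contains \<open>x\<close>, and its length
  \<open>L = 1/(\<beta>\<^sup>k(\<beta> - 1))\<close> does not depend on \<open>x\<close>. If it lies in a dyadic cell, then \<open>L \<le> 2\<^sup>-\<^sup>m\<close>, which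
  forces the lower bound on \<open>k\<close>. If it leaves the cell of \<open>x\<close>, then \<open>x\<close> is within \<open>L\<close> of an end point of
  that cell, so the exceptional set has measure at most \<open>2\<^sup>m \<cdot> 2 L\<close>, which is small as soon as \<open>k\<close> exceeds
  \<open>m log 2 / log \<beta>\<close> by a large constant.
\<close>

section \<open>States and intervals of the encoder\<close>

definition enc_sum :: "real \<Rightarrow> nat \<Rightarrow> (nat \<Rightarrow> real) \<Rightarrow> real \<Rightarrow> real" where
  "enc_sum \<beta> k u x = (\<Sum>n=1..k. enc_bit \<beta> u x n / \<beta> ^ n)"

definition enc_length :: "real \<Rightarrow> nat \<Rightarrow> real" where
  "enc_length \<beta> k = 1 / (\<beta> ^ k * (\<beta> - 1))"

lemma enc_interval_eq:
  "enc_interval \<beta> k u x = {enc_sum \<beta> k u x .. enc_sum \<beta> k u x + enc_length \<beta> k}"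
  by (simp add: enc_interval_def enc_sum_def enc_length_def)

lemma enc_length_pos: "1 < \<beta> \<Longrightarrow> 0 < enc_length \<beta> k"
  by (simp add: enc_length_def)

text \<open>The right end \<open>1 / (\<beta> - 1)\<close> is the fixed point of
  \<open>y \<mapsto> \<beta> * y - 1\<close>, so bit 1 respects the upper bound. The thresholds do
  the rest: \<open>1 \<le> u n\<close> keeps the state nonnegative after bit 1, and
  \<open>u n \<le> 1 / (\<beta> - 1)\<close> bounds it after bit 0.\<close>

lemma enc_state_bounds:
  assumes "1 < \<beta>" "\<And>n. n \<ge> 1 \<Longrightarrow> u n \<in> {1 .. 1 / (\<beta> - 1)}" "x \<in> {0 .. 1 / (\<beta> - 1)}"
  shows "enc_state \<beta> u x n \<in> {0 .. 1 / (\<beta> - 1)}"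
proof (induction n)
  case 0
  show ?case using assms(3) by simp
next
  case (Suc n)
  let ?y = "\<beta> * enc_state \<beta> u x n"
  have "?y \<le> \<beta> * (1 / (\<beta> - 1))"
    using Suc assms(1) by (intro mult_left_mono) auto
  also have "\<dots> = 1 / (\<beta> - 1) + 1"
    using assms(1) by (simp add: field_simps)
  finally have "?y - 1 \<le> 1 / (\<beta> - 1)" by simp
  moreover have "0 \<le> ?y" using Suc assms(1) by auto
  moreover have "1 \<le> u (Suc n)" "u (Suc n) \<le> 1 / (\<beta> - 1)"
    using assms(2)[of "Suc n"] by auto
  ultimately show ?case by (auto simp: quantize_def)
qed

text \<open>Unrolling the recursion gives the truncated expansion with its exact remainder.\<close>

lemma enc_sum_plus_state:
  assumes "1 < \<beta>"
  shows "x = enc_sum \<beta> k u x + enc_state \<beta> u x k / \<beta> ^ k"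
proof (induction k)
  case 0
  show ?case by (simp add: enc_sum_def)
next
  case (Suc k)
  have "enc_state \<beta> u x k / \<beta> ^ k =
      enc_bit \<beta> u x (Suc k) / \<beta> ^ Suc k + enc_state \<beta> u x (Suc k) / \<beta> ^ Suc k"
    using assms by (simp add: enc_bit_def field_simps)
  with Suc show ?case by (simp add: enc_sum_def)
qed

lemma mem_enc_interval:
  assumes "1 < \<beta>" "\<And>n. n \<ge> 1 \<Longrightarrow> u n \<in> {1 .. 1 / (\<beta> - 1)}" "x \<in> {0 .. 1 / (\<beta> - 1)}"
  shows "x \<in> enc_interval \<beta> k u x"
proof -
  let ?s = "enc_state \<beta> u x k"
  have "0 \<le> ?s" "?s \<le> 1 / (\<beta> - 1)" using enc_state_bounds[OF assms] by auto
  then have "0 \<le> ?s / \<beta> ^ k" "?s / \<beta> ^ k \<le> 1 / (\<beta> - 1) / \<beta> ^ k"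
    using assms(1) by (auto intro: divide_right_mono simp del: divide_divide_eq_left)
  then have "0 \<le> ?s / \<beta> ^ k" "?s / \<beta> ^ k \<le> enc_length \<beta> k"
    by (simp_all add: enc_length_def divide_simps mult.commute)
  then show ?thesis
    unfolding enc_interval_eq atLeastAtMost_iff using enc_sum_plus_state[OF assms(1), of x k u] by linarith
qed

section \<open>Dyadic cells and measurability\<close>

lemma dyadic_cell_eq:
  assumes "x \<in> {0..1}" "j \<le> 2 ^ m - 1" "x \<in> dyadic_interval m j"
  shows "dyadic_cell m x = dyadic_interval m j"
  unfolding dyadic_cell_def
  using the1_equality[OF dyadic_cell_unique[OF assms(1)], of "dyadic_interval m j" m] assms
  by (auto simp: dyadic_partition_def)

lemma obtain_dyadic_interval:
  assumes "x \<in> {0..1}"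
  obtains j where "j \<le> 2 ^ m - 1" "x \<in> dyadic_interval m j" "dyadic_cell m x = dyadic_interval m j"
proof -
  let ?j = "min (nat \<lfloor>x * 2 ^ m\<rfloor>) (2 ^ m - 1) :: nat"
  have "?j \<le> 2 ^ m - 1" "x \<in> dyadic_interval m ?j"
    using dyadic_interval_iff[OF assms, of ?j m] by auto
  then show thesis using that dyadic_cell_eq[OF assms] by blast
qed

text \<open>The right end of the exceptional last interval fits the general formula, so later
  arguments can treat all cells alike.\<close>

lemma dyadic_interval_last:
  fixes m :: nat
  defines "j \<equiv> 2 ^ m - 1 :: nat"
  shows "(real j + 1) / 2 ^ m = 1"
  by (simp add: j_def of_nat_diff)

lemma dyadic_interval_subset:
  "dyadic_interval m j \<subseteq> {real j / 2 ^ m .. (real j + 1) / 2 ^ m}"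
  using dyadic_interval_last[of m] by (auto simp: dyadic_interval_def)

lemma subset_dyadic_interval:
  "{real j / 2 ^ m <..< (real j + 1) / 2 ^ m} \<subseteq> dyadic_interval m j"
  using dyadic_interval_last[of m] by (auto simp: dyadic_interval_def)

text \<open>Cells are convex. Testing only the end points turns inclusion into a condition that is
  visibly measurable in \<open>x\<close>.\<close>

lemma interval_subset_dyadic_interval_iff:
  "a \<le> b \<Longrightarrow> {a..b} \<subseteq> dyadic_interval m j \<longleftrightarrow> a \<in> dyadic_interval m j \<and> b \<in> dyadic_interval m j"
  by (auto simp: dyadic_interval_def)

lemma dyadic_interval_borel [measurable]: "dyadic_interval m j \<in> sets borel"
  by (simp add: dyadic_interval_def)

lemma enc_state_measurable [measurable]: "(\<lambda>x. enc_state \<beta> u x n) \<in> borel_measurable borel"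
  by (induction n) (simp_all add: quantize_def)

lemma enc_sum_measurable [measurable]: "enc_sum \<beta> k u \<in> borel_measurable borel"
  unfolding enc_sum_def enc_bit_def quantize_def by measurable

section \<open>The index and its lower bound\<close>

text \<open>Removes the infimum: both claims of the theorem reduce to statements about single values
  of \<open>k\<close>. If no \<open>k\<close> is admissible, the index is infinite and both sides
  hold.\<close>

lemma less_enc_index_iff:
  "ereal t < ereal_of_enat (enc_index \<beta> m u x) \<longleftrightarrow>
     (\<forall>k\<ge>1. enc_interval \<beta> k u x \<subseteq> dyadic_cell m x \<longrightarrow> t < real k)"
proof -
  let ?S = "{enat k | k. k \<ge> 1 \<and> enc_interval \<beta> k u x \<subseteq> dyadic_cell m x}"
  show ?thesis
  proof (cases "?S = {}")
    case True
    then have "enc_index \<beta> m u x = \<infinity>"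
      unfolding enc_index_def True by (simp add: top_enat_def)
    with True show ?thesis by auto
  next
    case False
    \<comment> \<open>A nonempty infimum is attained because \<open>enat\<close> is
      well-ordered.\<close>
    then have "Inf ?S \<in> ?S" by (meson ex_in_conv wellorder_InfI)
    then obtain k where k: "Inf ?S = enat k" "k \<ge> 1" "enc_interval \<beta> k u x \<subseteq> dyadic_cell m x"
      by blast
    have "k \<le> l" if "l \<ge> 1" "enc_interval \<beta> l u x \<subseteq> dyadic_cell m x" for l
      using Inf_lower[of "enat l" ?S] that k(1) by auto
    then show ?thesis
      using k unfolding enc_index_def by fastforce
  qed
qed

lemma less_enat_minus_ereal_iff:
  "ereal c < ereal_of_enat e - ereal r \<longleftrightarrow> ereal (r + c) < ereal_of_enat e"
  by (cases e) auto

text \<open>Comparing lengths gives \<open>2 ^ m \<le> \<beta> ^ k * (\<beta> - 1)\<close>, and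
  \<open>\<beta> - 1 < 1\<close> makes the bound strict.\<close>

lemma enc_interval_subset_cell_imp:
  assumes "1 < \<beta>" "\<beta> < 2" "x \<in> {0..1}" "enc_interval \<beta> k u x \<subseteq> dyadic_cell m x"
  shows "2 ^ m < \<beta> ^ k"
proof -
  obtain j where j: "dyadic_cell m x = dyadic_interval m j"
    using obtain_dyadic_interval[OF assms(3)] by metis
  have "{enc_sum \<beta> k u x .. enc_sum \<beta> k u x + enc_length \<beta> k} \<subseteq>
      {real j / 2 ^ m .. (real j + 1) / 2 ^ m}"
    using assms(4) dyadic_interval_subset[of m j] unfolding j enc_interval_eq by blast
  then have "enc_length \<beta> k \<le> (real j + 1) / 2 ^ m - real j / 2 ^ m"
    using enc_length_pos[OF assms(1), of k] by auto
  then have "1 / (\<beta> ^ k * (\<beta> - 1)) \<le> 1 / 2 ^ m"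
    by (simp add: enc_length_def diff_divide_distrib[symmetric])
  then have "2 ^ m \<le> \<beta> ^ k * (\<beta> - 1)" using assms(1) by (simp add: field_simps)
  also have "\<dots> < \<beta> ^ k" using assms(1,2) by simp
  finally show ?thesis .
qed

section \<open>The exceptional set at a fixed stage\<close>

definition unresolved :: "real \<Rightarrow> nat \<Rightarrow> (nat \<Rightarrow> real) \<Rightarrow> nat \<Rightarrow> real set" where
  "unresolved \<beta> k u m = {x \<in> {0..1}. \<not> enc_interval \<beta> k u x \<subseteq> dyadic_cell m x}"

text \<open>The cell varies with \<open>x\<close>; splitting by the finitely many cells replaces it
  by a fixed interval on each piece.\<close>

lemma unresolved_borel:
  assumes "1 < \<beta>"
  shows "unresolved \<beta> k u m \<in> sets borel"
proof -
  let ?A = "\<lambda>j. {x \<in> {0..1}. x \<in> dyadic_interval m j \<and> \<not> (enc_sum \<beta> k u x \<in> dyadic_interval m j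
      \<and> enc_sum \<beta> k u x + enc_length \<beta> k \<in> dyadic_interval m j)}"
  have iff: "enc_interval \<beta> k u x \<subseteq> dyadic_interval m j \<longleftrightarrow> enc_sum \<beta> k u x \<in> dyadic_interval m j
      \<and> enc_sum \<beta> k u x + enc_length \<beta> k \<in> dyadic_interval m j" for x j
    unfolding enc_interval_eq using enc_length_pos[OF assms, of k]
    by (intro interval_subset_dyadic_interval_iff) auto
  have "unresolved \<beta> k u m =
      (\<Union>j\<in>{..2 ^ m - 1}. {x \<in> {0..1}. x \<in> dyadic_interval m j \<and>
        \<not> enc_interval \<beta> k u x \<subseteq> dyadic_interval m j})" (is "_ = ?U")
  proof (intro equalityI subsetI)
    fix x assume x: "x \<in> unresolved \<beta> k u m"
    then have "x \<in> {0..1}" by (simp add: unresolved_def)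
    then obtain j where "j \<le> 2 ^ m - 1" "x \<in> dyadic_interval m j"
      "dyadic_cell m x = dyadic_interval m j"
      by (rule obtain_dyadic_interval)
    with x show "x \<in> ?U" unfolding unresolved_def by blast
  next
    fix x assume "x \<in> ?U"
    then obtain j where j: "x \<in> {0..1}" "j \<le> 2 ^ m - 1" "x \<in> dyadic_interval m j"
      "\<not> enc_interval \<beta> k u x \<subseteq> dyadic_interval m j" by blast
    then show "x \<in> unresolved \<beta> k u m" by (simp add: unresolved_def dyadic_cell_eq[OF j(1-3)])
  qed
  also have "\<dots> = (\<Union>j\<in>{..2 ^ m - 1}. ?A j)"
    unfolding iff ..
  also have "\<dots> \<in> sets borel" by measurable
  finally show ?thesis .
qed

lemma emeasure_unresolved_le:
  assumes "1 < \<beta>" "\<beta> < 2" "\<And>n. n \<ge> 1 \<Longrightarrow> u n \<in> {1 .. 1 / (\<beta> - 1)}"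
  shows "emeasure lborel (unresolved \<beta> k u m) \<le> ennreal (2 ^ m * (2 * enc_length \<beta> k))"
proof -
  let ?L = "enc_length \<beta> k"
  let ?l = "\<lambda>j. real j / 2 ^ m" and ?r = "\<lambda>j. (real j + 1) / 2 ^ m"
  \<comment> \<open>The two strips at the ends of a cell may overlap or stick out of it; a union
    bound tolerates both.\<close>
  let ?B = "\<lambda>j. {?l j .. ?l j + ?L} \<union> {?r j - ?L .. ?r j}"
  have L: "0 \<le> ?L" using enc_length_pos[OF assms(1), of k] by simp
  have "unresolved \<beta> k u m \<subseteq> (\<Union>j\<in>{..<2 ^ m}. ?B j)"
  proof
    fix x assume "x \<in> unresolved \<beta> k u m"
    then have x: "x \<in> {0..1}" and out: "\<not> enc_interval \<beta> k u x \<subseteq> dyadic_cell m x"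
      by (auto simp: unresolved_def)
    obtain j where j: "j \<le> 2 ^ m - 1" "x \<in> dyadic_interval m j"
      "dyadic_cell m x = dyadic_interval m j"
      using obtain_dyadic_interval[OF x] .
    have "1 \<le> 1 / (\<beta> - 1)" using assms(1,2) by simp
    with x have "x \<in> {0 .. 1 / (\<beta> - 1)}" by auto
    then have "x \<in> enc_interval \<beta> k u x"
      using mem_enc_interval assms(1,3) by blast
    then have mem: "enc_sum \<beta> k u x \<le> x" "x \<le> enc_sum \<beta> k u x + ?L"
      by (auto simp: enc_interval_eq)
    have "x \<in> ?B j"
    proof (rule ccontr)
      assume "x \<notin> ?B j"
      with j(2) dyadic_interval_subset[of m j] have "?l j + ?L < x" "x < ?r j - ?L" by auto
      \<comment> \<open>An interval of length \<open>?L\<close> containing \<open>x\<close> lies in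
        \<open>{x - ?L .. x + ?L}\<close>.\<close>
      with mem have "enc_interval \<beta> k u x \<subseteq> {?l j <..< ?r j}"
        by (auto simp: enc_interval_eq)
      with subset_dyadic_interval[of j m] j(3) out show False by blast
    qed
    moreover have "j < 2 ^ m" using j(1) by (simp add: le_less_trans)
    ultimately show "x \<in> (\<Union>j\<in>{..<2 ^ m}. ?B j)" by blast
  qed
  then have "emeasure lborel (unresolved \<beta> k u m) \<le> emeasure lborel (\<Union>j\<in>{..<2 ^ m}. ?B j)"
    by (intro emeasure_mono) auto
  also have "\<dots> \<le> (\<Sum>j\<in>{..<2 ^ m}. emeasure lborel (?B j))"
    by (intro emeasure_subadditive_finite) auto
  also have "\<dots> \<le> (\<Sum>j\<in>{..<(2::nat) ^ m}. ennreal (2 * ?L))"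
  proof (intro sum_mono)
    fix j
    have "emeasure lborel (?B j) \<le>
        emeasure lborel {?l j .. ?l j + ?L} + emeasure lborel {?r j - ?L .. ?r j}"
      by (intro emeasure_subadditive) auto
    also have "\<dots> = ennreal (2 * ?L)" using L by (simp add: ennreal_plus[symmetric] del: ennreal_plus)
    finally show "emeasure lborel (?B j) \<le> ennreal (2 * ?L)" .
  qed
  also have "\<dots> = ennreal (2 ^ m * (2 * ?L))"
    using L by (subst sum_ennreal) auto
  finally show ?thesis .
qed

theorem theorem1p1:
  fixes \<beta> :: real and u :: "nat \<Rightarrow> real"
  assumes "1 < \<beta>" and "\<beta> < 2"
    and "\<And>n. n \<ge> 1 \<Longrightarrow> u n \<in> {1 .. 1 / (\<beta> - 1)}"
  shows "(\<forall>x\<in>{0..1}. \<forall>m\<ge>1.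
            ereal_of_enat (enc_index \<beta> m u x) \<ge> ereal (real m * ln 2 / ln \<beta>))
       \<and> (\<forall>\<epsilon>::real. 0 < \<epsilon> \<and> \<epsilon> < 1 \<longrightarrow>
            (\<exists>C::real. C > 0 \<and>
              (\<forall>m\<ge>1.
                {x \<in> {0..1}. ereal_of_enat (enc_index \<beta> m u x) - ereal (real m * ln 2 / ln \<beta>)
                   > ereal C} \<in> sets lebesgue
                \<and> emeasure lebesgue
                    {x \<in> {0..1}. ereal_of_enat (enc_index \<beta> m u x) - ereal (real m * ln 2 / ln \<beta>)
                       > ereal C} < ennreal \<epsilon>)))"
proof (intro conjI ballI allI impI)
  fix x :: real and m :: nat
  assume x: "x \<in> {0..1}"
  let ?r = "real m * ln 2 / ln \<beta>"
  have "?r < real k" if "enc_interval \<beta> k u x \<subseteq> dyadic_cell m x" for k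
  proof -
    have "ln (2 ^ m :: real) < ln (\<beta> ^ k)"
      using enc_interval_subset_cell_imp[OF assms(1,2) x that] assms(1) by (subst ln_less_cancel_iff) auto
    then show ?thesis using assms(1) by (simp add: ln_realpow pos_divide_less_eq)
  qed
  \<comment> \<open>The strict bound for every admissible \<open>k\<close> also covers an infinite
    index.\<close>
  then show "ereal_of_enat (enc_index \<beta> m u x) \<ge> ereal ?r"
    by (intro less_imp_le) (simp add: less_enc_index_iff)
next
  fix \<epsilon> :: real
  assume \<epsilon>: "0 < \<epsilon> \<and> \<epsilon> < 1"
  \<comment> \<open>\<open>Q\<close> is the factor by which \<open>\<beta> ^ k\<close> must exceed
    \<open>2 ^ m\<close> for the bound \<open>2 ^ m * (2 * enc_length \<beta> k)\<close> to drop
    below \<open>\<epsilon>\<close>.\<close>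
  define Q where "Q = 2 / (\<epsilon> * (\<beta> - 1))"
  have "\<epsilon> * (\<beta> - 1) < 1 * 1" using \<epsilon> assms(1,2) by (intro mult_strict_mono) auto
  then have Q: "1 < Q" using \<epsilon> assms(1) by (simp add: Q_def)
  \<comment> \<open>The logarithm supplies the factor \<open>Q\<close>; the summand 1 pays for
    rounding \<open>t\<close> down to an integer below. Neither term depends on
    \<open>m\<close>.\<close>
  define C where "C = 1 + log \<beta> Q"
  have C: "1 < C" using Q assms(1) by (simp add: C_def)
  let ?E = "\<lambda>C m. {x \<in> {0..1}.
    ereal_of_enat (enc_index \<beta> m u x) - ereal (real m * ln 2 / ln \<beta>) > ereal C}"
  have "?E C m \<in> sets lebesgue \<and> emeasure lebesgue (?E C m) < ennreal \<epsilon>" for m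
  proof -
    define t where "t = real m * ln 2 / ln \<beta> + C"
    \<comment> \<open>The index exceeds \<open>t\<close> exactly if every stage up to
      \<open>t\<close> leaves \<open>x\<close> unresolved. This intersection is Borel, and its
      measure is bounded through the last such stage alone.\<close>
    define A where "A = {x \<in> {0..1}. \<forall>k\<ge>1. real k \<le> t \<longrightarrow> x \<in> unresolved \<beta> k u m}"
    have E: "?E C m = A"
      by (auto simp: A_def less_enat_minus_ereal_iff less_enc_index_iff t_def unresolved_def)
    have borel: "A \<in> sets borel"
      unfolding A_def using unresolved_borel[OF assms(1), of _ u m, measurable] by measurable
    define k where "k = nat \<lfloor>t\<rfloor>"
    have "0 \<le> real m * ln 2 / ln \<beta>" using assms(1) by simp
    then have "1 \<le> t" using C by (simp add: t_def)
    then have k: "k \<ge> 1" "real k \<le> t" "t - 1 < real k"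
      unfolding k_def by (auto simp: le_nat_iff le_floor_iff)
    \<comment> \<open>By the choice of \<open>C\<close>, \<open>t - 1\<close> is the base
      \<open>\<beta>\<close> logarithm of \<open>2 ^ m * Q\<close>.\<close>
    have "2 ^ m * Q = \<beta> powr (t - 1)"
    proof -
      have "real m * ln 2 / ln \<beta> = log \<beta> (2 ^ m)"
        by (simp add: log_def ln_realpow)
      then show ?thesis using assms(1) Q by (simp add: t_def C_def powr_add)
    qed
    also have "\<dots> < \<beta> powr real k" using k(3) assms(1) by simp
    also have "\<dots> = \<beta> ^ k" using assms(1) by (simp add: powr_realpow)
    finally have "2 ^ m * Q < \<beta> ^ k" .
    then have "2 ^ m * 2 < \<beta> ^ k * (\<epsilon> * (\<beta> - 1))"
      using \<epsilon> assms(1) unfolding Q_def by (simp add: pos_divide_less_eq)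
    then have small: "2 ^ m * (2 * enc_length \<beta> k) < \<epsilon>"
      using assms(1) unfolding enc_length_def by (simp add: pos_divide_less_eq mult_ac)
    have "emeasure lebesgue A = emeasure lborel A" using borel by simp
    also have "\<dots> \<le> emeasure lborel (unresolved \<beta> k u m)"
      using k(1,2) unresolved_borel[OF assms(1)] by (intro emeasure_mono) (auto simp: A_def)
    also have "\<dots> \<le> ennreal (2 ^ m * (2 * enc_length \<beta> k))"
      using emeasure_unresolved_le assms by blast
    also have "\<dots> < ennreal \<epsilon>"
      using small \<epsilon> by (intro ennreal_lessI) auto
    finally have "emeasure lebesgue A < ennreal \<epsilon>" .
    with borel show ?thesis unfolding E by simp
  qed
  moreover have "0 < C" using C by simp
  ultimately show "\<exists>C>0. \<forall>m\<ge>1. ?E C m \<in> sets lebesgue \<and> emeasure lebesgue (?E C m) < ennreal \<epsilon>"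
    by blast
qed

end
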